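(* A rule set $\mathcal{R}$ never-terminates if there is a cyclicity sequence for some KB with $\mathcal{R}$ and some head-choice.
   Context: Setting (restricted disjunctive chase). A (disjunctive existential) rule $\rho$ is a constant- and function-free formula $\forall \vec w,\vec x.[\beta(\vec w,\vec x)\to \bigvee_{i=1}^n \exists \vec y_i.\eta_i(\vec x_i,\vec y_i)]$ with $n\ge 1$, $\bigcup_i \vec x_i=\vec x$, and $\beta,\eta_i$ non-empty conjunctions of atoms; $\mathrm{frontier}(\rho)=\vec x$, $\mathrm{body}(\rho)=\beta$, $\mathrm{head}_i(\rho)=\eta_i$, $\mathrm{branching}(\rho)=n$. The rule is deterministic if $n=1$, generating if some $\vec y_i$ is non-empty, datalog if deterministic and non-generating. A substitution is a partial map from variables to ground terms. The skolemization $\mathrm{sk}(\rho)$ replaces each $y\in\vec y_i$ by $f^\rho_{i,y}(\vec x)$, where $f^\rho_{i,y}$ is a fresh function symbol unique for $(\rho,i,y)$. A trigger $\lambda=(\rho,\sigma)$ consists of a rule and a substitution with domain the body variables; it is loaded for a fact set $F$ if $\mathrm{body}(\rho)\sigma\subseteq F$, and obsolete for $F$ if some extension $\sigma'$ of $\sigma$ satisfies $\mathrm{head}_i(\rho)\sigma'\subseteq F$ for some $i$. $\mathrm{out}_i(\lambda)=\mathrm{head}_i(\mathrm{sk}(\rho))\sigma$. An $\mathcal{R}$-term is a term built from function symbols of $\mathrm{sk}(\mathcal{R})$, constants and variables; an $\mathcal{R}$-trigger is a trigger with a rule from $\mathcal{R}$ and a substitution whose range consists of $\mathcal{R}$-terms.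 A database is a function-free fact set and a KB is a pair $(\mathcal{R},D)$. A chase tree of $(\mathcal{R},D)$ is a directed tree whose vertices carry fact-labels (root labelled $D$) and whose non-root vertices carry trigger-labels, such that: every non-leaf vertex $v$ has, for some $\mathcal{R}$-trigger $\lambda=(\rho,\sigma)$ loaded and not obsolete for its fact-label (where, if $\rho$ is not datalog, the label of $v$ must satisfy all datalog rules of $\mathcal{R}$), exactly $\mathrm{branching}(\rho)$ children $c_i$ with fact-label (label of $v$)$\cup\mathrm{out}_i(\lambda)$ and trigger-label $\lambda$; every leaf label satisfies all rules of $\mathcal{R}$; and fairness holds (every $\mathcal{R}$-trigger loaded at some vertex $v$ is obsolete for all vertices reachable from $v$ by paths of some length $k$). $\mathcal{R}$ never-terminates if some KB with $\mathcal{R}$ has no finite chase tree. A head-choice $hc$ for $\mathcal{R}$ maps each $\rho\in\mathcal{R}$ to an element of $\{1,\dots,\mathrm{branching}(\rho)\}$; $\mathrm{out}_{hc}(\lambda)=\mathrm{out}_{hc(\rho)}(\lambda)$. For a chase tree $T$, $\mathrm{branch}(T,hc)=v_1,v_2,\dots$ is the branch from the root with label$(v_{i+1})$ = label$(v_i)\cup\mathrm{out}_{hc}(\text{trigger}(v_{i+1}))$. For a KB $K=(\mathcal{R},D)$, head-choice $hc$, and sequence $\Lambda=\lambda_1,\lambda_2,\dots$ of $\mathcal{R}$-triggers: $F_0=D$, $F_{i+1}=F_i\cup\mathrm{out}_{hc}(\lambda_{i+1})$; $\Lambda$ is loaded if each $\lambda_{i+1}$ is loaded for $F_i$; $\Lambda$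 is growing if for every $i$ there is $j>i$ and a term occurring in $F_j$ but not in $F_i$. An $\mathcal{R}$-trigger $\lambda$ is g-unblockable for $K$ and $hc$ if for every chase tree $T$ of $K$ and every vertex $v$ on $\mathrm{branch}(T,hc)$ for whose label $\lambda$ is loaded, some vertex $u$ on $\mathrm{branch}(T,hc)$ has $\mathrm{out}_{hc}(\lambda)\subseteq$ label$(u)$; $\Lambda$ is g-unblockable if all its triggers are. A cyclicity sequence of $K$ and $hc$ is an (infinite) sequence of $\mathcal{R}$-triggers that is loaded, growing and g-unblockable. *)

theory Defs
  imports Main "HOL-Library.Extended_Nat"
begin

section \<open>Terms, atoms, rules\<close>

datatype (funs: 'f, vars: 'v, constants: 'c) trm =
  Const 'c | Var 'v | Fun 'f "('f, 'v, 'c) trm list"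

text \<open>A predicate is identified with its name together with the length of the argument list, so
  no separate arity assignment is needed.\<close>

datatype ('p, 't) atom = Atom (pred: 'p) (args: "'t list")

text \<open>The atoms of a rule are constant- and function-free, so their arguments are variables.
  Conjunctions and disjunctions are lists.  The quantifier prefixes are determined by the atoms:
  the universally quantified variables are those of the body, and \<open>\<^bold>y\<^sub>i\<close> consists of the
  variables of the \<open>i\<close>-th head conjunction that do not occur in the body.\<close>

datatype ('p, 'v) rule =
  Rule (body: "('p, 'v) atom list") (heads: "('p, 'v) atom list list")

definition avars :: "('p, 'v) atom list \<Rightarrow> 'v set" where
  "avars as = (\<Union>a\<in>set as. set (args a))"

definition is_rule :: "('p, 'v) rule \<Rightarrow> bool" where
  "is_rule \<rho> \<longleftrightarrow> body \<rho> \<noteq> [] \<and> heads \<rho> \<noteq> [] \<and> (\<forall>\<eta>\<in>set (heads \<rho>). \<eta> \<noteq> [])"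

definition rule_set :: "('p, 'v) rule set \<Rightarrow> bool" where
  "rule_set R \<longleftrightarrow> (\<forall>\<rho>\<in>R. is_rule \<rho>)"

definition branching :: "('p, 'v) rule \<Rightarrow> nat" where
  "branching \<rho> = length (heads \<rho>)"

text \<open>Head conjunctions are counted from \<open>0\<close> to \<open>branching \<rho> - 1\<close>.\<close>

definition head :: "nat \<Rightarrow> ('p, 'v) rule \<Rightarrow> ('p, 'v) atom list" where
  "head i \<rho> = heads \<rho> ! i"

text \<open>The frontier is a list because it serves as the argument list of the Skolem terms.\<close>

definition frontier :: "('p, 'v) rule \<Rightarrow> 'v list" where
  "frontier \<rho> =
     filter (\<lambda>x. \<exists>i < branching \<rho>. x \<in> avars (head i \<rho>)) (remdups (concat (map args (body \<rho>))))"

definition exvars :: "nat \<Rightarrow> ('p, 'v) rule \<Rightarrow> 'v set" where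
  "exvars i \<rho> = avars (head i \<rho>) - avars (body \<rho>)"

definition deterministic :: "('p, 'v) rule \<Rightarrow> bool" where
  "deterministic \<rho> \<longleftrightarrow> branching \<rho> = 1"

definition generating :: "('p, 'v) rule \<Rightarrow> bool" where
  "generating \<rho> \<longleftrightarrow> (\<exists>i < branching \<rho>. exvars i \<rho> \<noteq> {})"

definition datalog :: "('p, 'v) rule \<Rightarrow> bool" where
  "datalog \<rho> \<longleftrightarrow> deterministic \<rho> \<and> \<not> generating \<rho>"


section \<open>Skolemization\<close>

text \<open>The Skolem function symbol \<open>f\<^sup>\<rho>\<^sub>i\<^sub>,\<^sub>y\<close> is the triple \<open>(\<rho>, i, y)\<close>, which makes it unique.\<close>

type_synonym ('p, 'v) skf = "('p, 'v) rule \<times> nat \<times> 'v"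
type_synonym ('p, 'v, 'c) sterm = "(('p, 'v) skf, 'v, 'c) trm"
type_synonym ('p, 'v, 'c) fact = "('p, ('p, 'v, 'c) sterm) atom"

definition sk_head :: "nat \<Rightarrow> ('p, 'v) rule \<Rightarrow> ('p, ('p, 'v, 'c) sterm) atom list" where
  "sk_head i \<rho> = map (map_atom id
     (\<lambda>z. if z \<in> exvars i \<rho> then Fun (\<rho>, i, z) (map Var (frontier \<rho>)) else Var z)) (head i \<rho>)"

text \<open>\<open>R\<close>-terms respect the arities of the Skolem function symbols of \<open>R\<close>.\<close>

inductive R_term :: "('p, 'v) rule set \<Rightarrow> ('p, 'v, 'c) sterm \<Rightarrow> bool" for R where
  "R_term R (Const c)"
| "R_term R (Var x)"
| "\<rho> \<in> R \<Longrightarrow> i < branching \<rho> \<Longrightarrow> y \<in> exvars i \<rho> \<Longrightarrow> length ts = length (frontier \<rho>) \<Longrightarrow>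
   (\<forall>t\<in>set ts. R_term R t) \<Longrightarrow> R_term R (Fun (\<rho>, i, y) ts)"


section \<open>Substitutions and fact sets\<close>

definition ground :: "('f, 'v, 'c) trm \<Rightarrow> bool" where
  "ground t \<longleftrightarrow> vars t = {}"

type_synonym ('p, 'v, 'c) subst = "'v \<rightharpoonup> ('p, 'v, 'c) sterm"

definition substitution :: "('p, 'v, 'c) subst \<Rightarrow> bool" where
  "substitution \<sigma> \<longleftrightarrow> (\<forall>t\<in>ran \<sigma>. ground t)"

fun subst_trm :: "('v \<rightharpoonup> ('f, 'v, 'c) trm) \<Rightarrow> ('f, 'v, 'c) trm \<Rightarrow> ('f, 'v, 'c) trm" where
  "subst_trm \<sigma> (Const c) = Const c"
| "subst_trm \<sigma> (Var x) = (case \<sigma> x of None \<Rightarrow> Var x | Some t \<Rightarrow> t)"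
| "subst_trm \<sigma> (Fun f ts) = Fun f (map (subst_trm \<sigma>) ts)"

definition subst_atoms ::
  "('p, 'v, 'c) subst \<Rightarrow> ('p, ('p, 'v, 'c) sterm) atom list \<Rightarrow> ('p, 'v, 'c) fact set" where
  "subst_atoms \<sigma> as = map_atom id (subst_trm \<sigma>) ` set as"

definition lift_atoms :: "('p, 'v) atom list \<Rightarrow> ('p, ('p, 'v, 'c) sterm) atom list" where
  "lift_atoms as = map (map_atom id Var) as"

fun subterms :: "('f, 'v, 'c) trm \<Rightarrow> ('f, 'v, 'c) trm set" where
  "subterms (Const c) = {Const c}"
| "subterms (Var x) = {Var x}"
| "subterms (Fun f ts) = insert (Fun f ts) (\<Union>t\<in>set ts. subterms t)"

definition terms_of :: "('p, 'v, 'c) fact set \<Rightarrow> ('p, 'v, 'c) sterm set" where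
  "terms_of F = (\<Union>a\<in>F. \<Union>t\<in>set (args a). subterms t)"

definition database :: "('p, 'v, 'c) fact set \<Rightarrow> bool" where
  "database D \<longleftrightarrow> (\<forall>a\<in>D. \<forall>t\<in>set (args a). ground t \<and> funs t = {})"


section \<open>Triggers\<close>

type_synonym ('p, 'v, 'c) trigger = "('p, 'v) rule \<times> ('p, 'v, 'c) subst"

definition trigger :: "('p, 'v, 'c) trigger \<Rightarrow> bool" where
  "trigger \<tau> \<longleftrightarrow> (case \<tau> of (\<rho>, \<sigma>) \<Rightarrow> is_rule \<rho> \<and> substitution \<sigma> \<and> dom \<sigma> = avars (body \<rho>))"

definition R_trigger :: "('p, 'v) rule set \<Rightarrow> ('p, 'v, 'c) trigger \<Rightarrow> bool" where
  "R_trigger R \<tau> \<longleftrightarrow> trigger \<tau> \<and> fst \<tau> \<in> R \<and> (\<forall>t\<in>ran (snd \<tau>). R_term R t)"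

definition loaded :: "('p, 'v, 'c) trigger \<Rightarrow> ('p, 'v, 'c) fact set \<Rightarrow> bool" where
  "loaded \<tau> F \<longleftrightarrow> (case \<tau> of (\<rho>, \<sigma>) \<Rightarrow> subst_atoms \<sigma> (lift_atoms (body \<rho>)) \<subseteq> F)"

definition obsolete :: "('p, 'v, 'c) trigger \<Rightarrow> ('p, 'v, 'c) fact set \<Rightarrow> bool" where
  "obsolete \<tau> F \<longleftrightarrow> (case \<tau> of (\<rho>, \<sigma>) \<Rightarrow>
     \<exists>\<sigma>'. substitution \<sigma>' \<and> \<sigma> \<subseteq>\<^sub>m \<sigma>' \<and>
       (\<exists>i < branching \<rho>. subst_atoms \<sigma>' (lift_atoms (head i \<rho>)) \<subseteq> F))"

definition out :: "nat \<Rightarrow> ('p, 'v, 'c) trigger \<Rightarrow> ('p, 'v, 'c) fact set" where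
  "out i \<tau> = (case \<tau> of (\<rho>, \<sigma>) \<Rightarrow> subst_atoms \<sigma> (sk_head i \<rho>))"

definition satisfies :: "('p, 'v, 'c) fact set \<Rightarrow> ('p, 'v) rule \<Rightarrow> bool" where
  "satisfies F \<rho> \<longleftrightarrow> (\<forall>\<sigma>. trigger (\<rho>, \<sigma>) \<longrightarrow> loaded (\<rho>, \<sigma>) F \<longrightarrow> obsolete (\<rho>, \<sigma>) F)"


section \<open>Chase trees\<close>

text \<open>The trigger-label of the root is irrelevant.\<close>

record ('n, 'p, 'v, 'c) labelled_tree =
  verts :: "'n set"
  edges :: "('n \<times> 'n) set"
  tree_root :: 'n
  fact_label :: "'n \<Rightarrow> ('p, 'v, 'c) fact set"
  trig_label :: "'n \<Rightarrow> ('p, 'v, 'c) trigger"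

definition directed_tree :: "('n, 'p, 'v, 'c) labelled_tree \<Rightarrow> bool" where
  "directed_tree T \<longleftrightarrow>
     edges T \<subseteq> verts T \<times> verts T \<and> tree_root T \<in> verts T \<and>
     (\<forall>u. (u, tree_root T) \<notin> edges T) \<and>
     (\<forall>v\<in>verts T - {tree_root T}. \<exists>!u. (u, v) \<in> edges T) \<and>
     (\<forall>v\<in>verts T. (tree_root T, v) \<in> (edges T)\<^sup>*)"

definition children :: "('n, 'p, 'v, 'c) labelled_tree \<Rightarrow> 'n \<Rightarrow> 'n set" where
  "children T v = {c. (v, c) \<in> edges T}"

definition leaf :: "('n, 'p, 'v, 'c) labelled_tree \<Rightarrow> 'n \<Rightarrow> bool" where
  "leaf T v \<longleftrightarrow> children T v = {}"

definition chase_tree ::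
  "('p, 'v) rule set \<Rightarrow> ('p, 'v, 'c) fact set \<Rightarrow> ('n, 'p, 'v, 'c) labelled_tree \<Rightarrow> bool" where
  "chase_tree R D T \<longleftrightarrow>
     directed_tree T \<and>
     fact_label T (tree_root T) = D \<and>
     (\<forall>v\<in>verts T. \<not> leaf T v \<longrightarrow>
       (\<exists>\<tau>. R_trigger R \<tau> \<and> loaded \<tau> (fact_label T v) \<and> \<not> obsolete \<tau> (fact_label T v) \<and>
         (\<not> datalog (fst \<tau>) \<longrightarrow> (\<forall>\<rho>\<in>R. datalog \<rho> \<longrightarrow> satisfies (fact_label T v) \<rho>)) \<and>
         (\<exists>cs. distinct cs \<and> length cs = branching (fst \<tau>) \<and> set cs = children T v \<and>
           (\<forall>i < branching (fst \<tau>).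
             fact_label T (cs ! i) = fact_label T v \<union> out i \<tau> \<and> trig_label T (cs ! i) = \<tau>)))) \<and>
     (\<forall>v\<in>verts T. leaf T v \<longrightarrow> (\<forall>\<rho>\<in>R. satisfies (fact_label T v) \<rho>)) \<and>
     (\<forall>\<tau>. \<forall>v\<in>verts T. R_trigger R \<tau> \<longrightarrow> loaded \<tau> (fact_label T v) \<longrightarrow>
       (\<exists>k. \<forall>u. (v, u) \<in> edges T ^^ k \<longrightarrow> obsolete \<tau> (fact_label T u)))"

text \<open>Every vertex of a chase tree has finitely many children, so chase trees are countable and it
  is no restriction to draw their vertices from \<^typ>\<open>nat\<close>.  The constants do not occur in rules,
  hence their type is passed explicitly.\<close>

definition never_terminates :: "'c itself \<Rightarrow> ('p, 'v) rule set \<Rightarrow> bool" where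
  "never_terminates _ R \<longleftrightarrow>
     (\<exists>D :: ('p, 'v, 'c) fact set. database D \<and>
       \<not> (\<exists>T :: (nat, 'p, 'v, 'c) labelled_tree. chase_tree R D T \<and> finite (verts T)))"


section \<open>Cyclicity sequences\<close>

type_synonym ('p, 'v) head_choice = "('p, 'v) rule \<Rightarrow> nat"

definition head_choice :: "('p, 'v) rule set \<Rightarrow> ('p, 'v) head_choice \<Rightarrow> bool" where
  "head_choice R hc \<longleftrightarrow> (\<forall>\<rho>\<in>R. hc \<rho> < branching \<rho>)"

definition out_hc :: "('p, 'v) head_choice \<Rightarrow> ('p, 'v, 'c) trigger \<Rightarrow> ('p, 'v, 'c) fact set" where
  "out_hc hc \<tau> = out (hc (fst \<tau>)) \<tau>"

text \<open>\<open>hc_branch T hc N b\<close>: the vertices \<open>b 0, b 1, \<dots>\<close> with index below \<open>N\<close> (possibly \<open>\<infinity>\<close>) form a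
  maximal path from the root along \<open>hc\<close>.  As siblings may carry equal fact-labels, such a branch
  need not be unique; \<open>g_unblockable\<close> considers all of them.  Exchanging the subtrees of two
  siblings with equal labels yields a chase tree again, so, as \<open>g_unblockable\<close> ranges over all
  chase trees, this agrees with following the \<open>hc\<close>-th child in an ordered tree.\<close>

definition hc_branch ::
  "('n, 'p, 'v, 'c) labelled_tree \<Rightarrow> ('p, 'v) head_choice \<Rightarrow> enat \<Rightarrow> (nat \<Rightarrow> 'n) \<Rightarrow> bool" where
  "hc_branch T hc N b \<longleftrightarrow>
     0 < N \<and> b 0 = tree_root T \<and>
     (\<forall>i. enat (Suc i) < N \<longrightarrow>
       (b i, b (Suc i)) \<in> edges T \<and>
       fact_label T (b (Suc i)) = fact_label T (b i) \<union> out_hc hc (trig_label T (b (Suc i)))) \<and>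
     (\<forall>i. enat (Suc i) = N \<longrightarrow> leaf T (b i))"

definition g_unblockable ::
  "('p, 'v) rule set \<Rightarrow> ('p, 'v, 'c) fact set \<Rightarrow> ('p, 'v) head_choice \<Rightarrow>
   ('p, 'v, 'c) trigger \<Rightarrow> bool" where
  "g_unblockable R D hc \<tau> \<longleftrightarrow>
     (\<forall>(T :: (nat, 'p, 'v, 'c) labelled_tree) N b. chase_tree R D T \<longrightarrow> hc_branch T hc N b \<longrightarrow>
       (\<forall>i. enat i < N \<longrightarrow> loaded \<tau> (fact_label T (b i)) \<longrightarrow>
         (\<exists>j. enat j < N \<and> out_hc hc \<tau> \<subseteq> fact_label T (b j))))"

text \<open>Sequences of triggers are indexed from \<open>0\<close>.\<close>

primrec seq_facts ::
  "('p, 'v, 'c) fact set \<Rightarrow> ('p, 'v) head_choice \<Rightarrow> (nat \<Rightarrow> ('p, 'v, 'c) trigger) \<Rightarrow> nat \<Rightarrow>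
   ('p, 'v, 'c) fact set" where
  "seq_facts D hc \<Lambda> 0 = D"
| "seq_facts D hc \<Lambda> (Suc i) = seq_facts D hc \<Lambda> i \<union> out_hc hc (\<Lambda> i)"

definition loaded_seq ::
  "('p, 'v, 'c) fact set \<Rightarrow> ('p, 'v) head_choice \<Rightarrow> (nat \<Rightarrow> ('p, 'v, 'c) trigger) \<Rightarrow> bool" where
  "loaded_seq D hc \<Lambda> \<longleftrightarrow> (\<forall>i. loaded (\<Lambda> i) (seq_facts D hc \<Lambda> i))"

definition growing_seq ::
  "('p, 'v, 'c) fact set \<Rightarrow> ('p, 'v) head_choice \<Rightarrow> (nat \<Rightarrow> ('p, 'v, 'c) trigger) \<Rightarrow> bool" where
  "growing_seq D hc \<Lambda> \<longleftrightarrow>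
     (\<forall>i. \<exists>j > i. \<exists>t. t \<in> terms_of (seq_facts D hc \<Lambda> j) \<and> t \<notin> terms_of (seq_facts D hc \<Lambda> i))"

definition cyclicity_sequence ::
  "('p, 'v) rule set \<Rightarrow> ('p, 'v, 'c) fact set \<Rightarrow> ('p, 'v) head_choice \<Rightarrow>
   (nat \<Rightarrow> ('p, 'v, 'c) trigger) \<Rightarrow> bool" where
  "cyclicity_sequence R D hc \<Lambda> \<longleftrightarrow>
     (\<forall>i. R_trigger R (\<Lambda> i)) \<and> loaded_seq D hc \<Lambda> \<and> growing_seq D hc \<Lambda> \<and>
     (\<forall>i. g_unblockable R D hc (\<Lambda> i))"

end

(* Along the head-choice, a finite chase tree has a branch that ends in a leaf. By unblockability and
   induction, the label of this leaf contains all facts generated by a cyclicity sequence. But the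
   label arises from the database by adding finitely many facts, hence finitely many terms, which
   contradicts growth. (The database itself may be infinite.) *)

theory Submission
  imports Defs
begin

lemma finite_subterms: "finite (subterms t)"
  by (induction t) auto

lemma terms_of_mono: "F \<subseteq> G \<Longrightarrow> terms_of F \<subseteq> terms_of G"
  unfolding terms_of_def by blast

lemma terms_of_Un: "terms_of (F \<union> G) = terms_of F \<union> terms_of G"
  unfolding terms_of_def by blast

lemma finite_terms_of: "finite F \<Longrightarrow> finite (terms_of F)"
  by (simp add: terms_of_def finite_subterms)

lemma finite_out_hc: "finite (out_hc hc \<tau>)"
  by (simp add: out_hc_def out_def subst_atoms_def split: prod.split)

lemma loaded_mono: "loaded \<tau> F \<Longrightarrow> F \<subseteq> G \<Longrightarrow> loaded \<tau> G"
  by (auto simp: loaded_def)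

lemma seq_facts_mono: "i \<le> j \<Longrightarrow> seq_facts D hc \<Lambda> i \<subseteq> seq_facts D hc \<Lambda> j"
  by (rule lift_Suc_mono_le) auto

text \<open>Growth rules out that the increasing term sets take only finitely many values. The terms
  of \<open>D\<close> are subtracted because \<open>D\<close> may be infinite, so that infinitely
  many terms in \<open>G\<close> alone would say nothing.\<close>

lemma infinite_terms_of_growing_seq:
  assumes "growing_seq D hc \<Lambda>"
    and "\<And>i. seq_facts D hc \<Lambda> i \<subseteq> G"
  shows "infinite (terms_of G - terms_of D)"
proof
  define S where "S i = terms_of (seq_facts D hc \<Lambda> i)" for i
  assume fin: "finite (terms_of G - terms_of D)"
  \<comment> \<open>Lying between \<open>terms_of D\<close> and \<open>terms_of G\<close>, each
    \<open>S i\<close> is determined by its part outside \<open>terms_of D\<close>, a subset of a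
    finite set.\<close>
  have "S i \<in> (\<union>) (terms_of D) ` Pow (terms_of G - terms_of D)" for i
  proof (rule image_eqI)
    show "S i = terms_of D \<union> (S i - terms_of D)"
      using terms_of_mono[OF seq_facts_mono[of 0 i D hc \<Lambda>]] by (auto simp: S_def)
    show "S i - terms_of D \<in> Pow (terms_of G - terms_of D)"
      using terms_of_mono[OF assms(2)] by (auto simp: S_def)
  qed
  then have "finite (range S)"
    by (meson fin finite_Pow_iff finite_imageI finite_subset image_subsetI)
  \<comment> \<open>\<open>S\<close> is increasing, so from a maximal value on it would be constant;
    growth supplies a later index with a further term.\<close>
  then obtain i where max: "\<And>j. S i \<subseteq> S j \<Longrightarrow> S i = S j"
    using finite_has_maximal[of "range S"] by auto
  obtain j t where "j > i" "t \<in> S j" "t \<notin> S i"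
    using assms(1) unfolding growing_seq_def S_def by blast
  moreover have "S i \<subseteq> S j"
    unfolding S_def using \<open>j > i\<close> by (intro terms_of_mono seq_facts_mono) simp
  ultimately show False
    using max by blast
qed

text \<open>Parents are unique, so a coincidence of two vertices on the path can be pulled back step
  by step until the root coincides with a later vertex, which has a parent.\<close>

lemma inj_path_from_root:
  assumes "directed_tree T" and "b 0 = tree_root T" and "\<And>i. (b i, b (Suc i)) \<in> edges T"
  shows "inj b"
proof -
  have edges: "edges T \<subseteq> verts T \<times> verts T"
    and root: "\<And>u. (u, tree_root T) \<notin> edges T"
    and parent: "\<And>v. v \<in> verts T - {tree_root T} \<Longrightarrow> \<exists>!u. (u, v) \<in> edges T"
    using assms(1) unfolding directed_tree_def by auto
  have "b i \<noteq> b j" if "i < j" for i j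
    using that
  proof (induction i arbitrary: j)
    case 0
    then show ?case
      using root assms(2,3) by (metis gr0_implies_Suc)
  next
    case (Suc i)
    then obtain k where k: "j = Suc k" "i < k"
      by (cases j) auto
    have "b (Suc i) \<in> verts T - {tree_root T}"
      using assms(3)[of i] edges root by auto
    then show ?case
      using parent[of "b (Suc i)"] assms(3)[of i] assms(3)[of k] Suc.IH[OF k(2)] k(1) by auto
  qed
  then show ?thesis
    by (metis injI linorder_neqE_nat)
qed

text \<open>The children are indexed by the heads of the trigger, and a head-choice picks a valid
  index. The child carries this trigger as its own label, so the equation takes the form that
  \<open>hc_branch\<close> demands.\<close>

lemma hc_child_exists:
  assumes "chase_tree R D T" and "head_choice R hc" and "v \<in> verts T" and "\<not> leaf T v"
  shows "\<exists>c. (v, c) \<in> edges T \<and>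
    fact_label T c = fact_label T v \<union> out_hc hc (trig_label T c)"
proof -
  obtain \<tau> cs where \<tau>: "R_trigger R \<tau>" "length cs = branching (fst \<tau>)" "set cs = children T v"
    "\<And>i. i < branching (fst \<tau>) \<Longrightarrow>
      fact_label T (cs ! i) = fact_label T v \<union> out i \<tau> \<and> trig_label T (cs ! i) = \<tau>"
    using assms(1,3,4) unfolding chase_tree_def by meson
  have hc: "hc (fst \<tau>) < branching (fst \<tau>)"
    using \<tau>(1) assms(2) by (auto simp: R_trigger_def head_choice_def)
  then have "cs ! hc (fst \<tau>) \<in> children T v"
    using \<tau>(2,3) nth_mem by metis
  then show ?thesis
    using \<tau>(4)[OF hc] by (auto simp: children_def out_hc_def)
qed

text \<open>A walk along chosen children that never met a leaf would embed the natural numbers into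
  the finite vertex set.\<close>

lemma finite_chase_tree_hc_branch:
  assumes "chase_tree R D T" and "head_choice R hc" and "finite (verts T)"
  obtains b n where "hc_branch T hc (enat (Suc n)) b"
proof -
  have tree: "directed_tree T"
    using assms(1) by (simp add: chase_tree_def)
  define step_to where "step_to v = (SOME c. (v, c) \<in> edges T \<and>
    fact_label T c = fact_label T v \<union> out_hc hc (trig_label T c))" for v
  have step_to: "(v, step_to v) \<in> edges T"
      "fact_label T (step_to v) = fact_label T v \<union> out_hc hc (trig_label T (step_to v))"
    if "v \<in> verts T" "\<not> leaf T v" for v
    using someI_ex[OF hc_child_exists[OF assms(1,2) that]] unfolding step_to_def by auto
  define b where "b i = (step_to ^^ i) (tree_root T)" for i
  have b0: "b 0 = tree_root T" and bSuc: "\<And>i. b (Suc i) = step_to (b i)"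
    by (auto simp: b_def)
  \<comment> \<open>\<open>step_to\<close> is unspecified at leaves, so membership is claimed only
    up to the first leaf.\<close>
  have verts: "b i \<in> verts T" if "\<forall>j<i. \<not> leaf T (b j)" for i
    using that
  proof (induction i)
    case 0
    then show ?case
      using tree by (simp add: b0 directed_tree_def)
  next
    case (Suc i)
    then have "(b i, b (Suc i)) \<in> edges T"
      using step_to(1)[of "b i"] by (simp add: bSuc)
    then show ?case
      using tree by (auto simp: directed_tree_def)
  qed
  have "\<exists>n. leaf T (b n)"
  proof (rule ccontr)
    assume "\<nexists>n. leaf T (b n)"
    then have "b i \<in> verts T" "(b i, b (Suc i)) \<in> edges T" for i
      using verts step_to(1) bSuc by auto
    then have "inj b" "range b \<subseteq> verts T"
      using inj_path_from_root[of T b] tree b0 by auto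
    then show False
      using assms(3) finite_subset range_inj_infinite by blast
  qed
  \<comment> \<open>With the least such \<open>n\<close>, every earlier vertex is a non-leaf, where
    \<open>step_to\<close> behaves as intended. The branch consists of \<open>b 0\<close> to
    \<open>b n\<close>, hence its length \<open>Suc n\<close>.\<close>
  then obtain n where n: "leaf T (b n)" "\<forall>j<n. \<not> leaf T (b j)"
    using exists_least_iff[of "\<lambda>n. leaf T (b n)"] by blast
  then have "hc_branch T hc (enat (Suc n)) b"
    using b0 verts step_to by (auto simp: hc_branch_def bSuc zero_enat_def)
  then show thesis
    by (rule that)
qed

theorem theorem1:
  fixes R :: "('p, 'v) rule set"
  assumes "rule_set R"
    and "\<exists>(D :: ('p, 'v, 'c) fact set) hc \<Lambda>.
      database D \<and> head_choice R hc \<and> cyclicity_sequence R D hc \<Lambda>"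
  shows "never_terminates TYPE('c) R"
proof -
  obtain D :: "('p, 'v, 'c) fact set" and hc \<Lambda>
    where D: "database D" and hc: "head_choice R hc" and "cyclicity_sequence R D hc \<Lambda>"
    using assms(2) by blast
  then have loaded: "\<And>i. loaded (\<Lambda> i) (seq_facts D hc \<Lambda> i)"
    and growing: "growing_seq D hc \<Lambda>"
    and unblockable: "\<And>i. g_unblockable R D hc (\<Lambda> i)"
    by (auto simp: cyclicity_sequence_def loaded_seq_def)
  have False if T: "chase_tree R D T" "finite (verts T)"
    for T :: "(nat, 'p, 'v, 'c) labelled_tree"
  proof -
    obtain b n where b: "hc_branch T hc (enat (Suc n)) b"
      using finite_chase_tree_hc_branch[OF T(1) hc T(2)] .
    define L where "L i = fact_label T (b i)" for i
    have step: "L (Suc i) = L i \<union> out_hc hc (trig_label T (b (Suc i)))" if "i < n" for i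
      using b that by (simp add: hc_branch_def L_def)
    have root: "L 0 = D"
      using b T(1) by (simp add: hc_branch_def chase_tree_def L_def)
    have mono: "L j \<subseteq> L n" if "j \<le> n" for j
      using that by (induction rule: inc_induct) (use step in auto)
    \<comment> \<open>Each of the finitely many steps adds one finite output; \<open>F\<close>
      collects what is added to \<open>D\<close>.\<close>
    have "\<exists>F. finite F \<and> L i = D \<union> F" if "i \<le> n" for i
      using that
    proof (induction i)
      case (Suc i)
      then obtain F where F: "finite F" "L i = D \<union> F"
        by auto
      have "L (Suc i) = D \<union> (F \<union> out_hc hc (trig_label T (b (Suc i))))"
        using step[of i] Suc.prems F(2) by auto
      then show ?case
        using F(1) finite_out_hc by (metis finite_UnI)
    qed (auto simp: root)
    then obtain F where F: "finite F" "L n = D \<union> F"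
      by blast
    have "seq_facts D hc \<Lambda> i \<subseteq> L n" for i
    proof (induction i)
      case 0
      then show ?case
        using F(2) by simp
    next
      case (Suc i)
      \<comment> \<open>The induction hypothesis loads the trigger at the leaf, so unblockability
        applies there. Its output may be found at an earlier vertex, from which \<open>mono\<close>
        carries it to the leaf.\<close>
      have "loaded (\<Lambda> i) (fact_label T (b n))"
        using loaded_mono[OF loaded Suc.IH] by (simp add: L_def)
      then obtain j where "enat j < enat (Suc n)" "out_hc hc (\<Lambda> i) \<subseteq> L j"
        using unblockable[of i] T(1) b unfolding g_unblockable_def L_def
        by (metis enat_ord_simps(2) lessI)
      then have "out_hc hc (\<Lambda> i) \<subseteq> L n"
        using mono[of j] by auto
      then show ?case
        using Suc.IH by simp
    qed
    then have "infinite (terms_of (L n) - terms_of D)"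
      using infinite_terms_of_growing_seq[OF growing] by blast
    moreover have "terms_of (L n) - terms_of D \<subseteq> terms_of F"
      by (auto simp: F(2) terms_of_Un)
    ultimately show False
      using finite_terms_of[OF F(1)] finite_subset by blast
  qed
  then show ?thesis
    unfolding never_terminates_def using D by blast
qed

end
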